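(* For $k=1,2$, let $G_k=(V_k,E_k)$ be a uniformly colored graph of type $(p,q_k,r_k)$ with degree $s_k$ and edge coloring function $c_k:E_k\to S$ (the same color set $S$ for both graphs). Suppose that the graphs $G_1$ and $G_2$ are disjoint. Define $c:E_1\cup E_2\to S$ by $c(e)=c_1(e)$ if $e\in E_1$ and $c(e)=c_2(e)$ if $e\in E_2$. Then the following are equivalent: (1) the disjoint union $G_1+G_2=(V_1\cup V_2,E_1\cup E_2)$, endowed with the coloring function $c$, is a uniformly colored graph; (2) $s_1=s_2$. Furthermore, if $G_1+G_2$ endowed with $c$ is uniformly colored, then it is of type $(p,q_1+q_2,r_1+r_2)$, with degree $s=s_1=s_2$.
   Context: Graphs have no loops or multiple edges. A uniform edge coloring of type $(p,q,r)$ ($p,q,r$ positive integers) with degree $s\ge 1$ on an undirected $s$-regular graph $(V,E)$ with $q$ vertices is a surjective map $c:E\to S$, $|S|=p$, such that adjacent edges have different colors (the coloring is proper) and $|c^{-1}(\{k\})|=r$ for every $k\in S$. A uniformly colored graph of type $(p,q,r)$ is a graph with such a coloring; a directed graph is uniformly colored of type $(p,q,r)$ if it is an undirected uniformly colored graph of type $(p,q,r)$ endowed with an orientation. *)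

theory Defs
  imports Main
begin

text \<open>
  Graphs are undirected, without loops or multiple edges: a vertex set together with a set of
  two-element subsets of it.
\<close>

definition simple_graph :: "'v set \<Rightarrow> 'v set set \<Rightarrow> bool" where
  "simple_graph V E \<longleftrightarrow> (\<forall>e\<in>E. e \<subseteq> V \<and> card e = 2)"

definition degree_at :: "'v set set \<Rightarrow> 'v \<Rightarrow> nat" where
  "degree_at E v = card {e \<in> E. v \<in> e}"

definition regular_graph :: "'v set \<Rightarrow> 'v set set \<Rightarrow> nat \<Rightarrow> bool" where
  "regular_graph V E s \<longleftrightarrow> simple_graph V E \<and> (\<forall>v\<in>V. degree_at E v = s)"

definition proper_edge_coloring :: "'v set set \<Rightarrow> ('v set \<Rightarrow> 'k) \<Rightarrow> bool" where
  "proper_edge_coloring E c \<longleftrightarrow>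
     (\<forall>e\<in>E. \<forall>f\<in>E. e \<noteq> f \<and> e \<inter> f \<noteq> {} \<longrightarrow> c e \<noteq> c f)"

text \<open>
  The coloring is a total function of which only the values on \<open>E\<close> matter. Positivity of
  \<open>p\<close>, \<open>q\<close>, \<open>r\<close> makes \<open>S\<close>, \<open>V\<close> and the color classes
  finite, since \<open>card\<close> of an infinite set is \<open>0\<close>.
\<close>

definition uniformly_colored_type ::
    "'v set \<Rightarrow> 'v set set \<Rightarrow> 'k set \<Rightarrow> ('v set \<Rightarrow> 'k) \<Rightarrow> nat \<Rightarrow> nat \<Rightarrow> nat \<Rightarrow> nat \<Rightarrow> bool" where
  "uniformly_colored_type V E S c p q r s \<longleftrightarrow>
     p \<ge> 1 \<and> q \<ge> 1 \<and> r \<ge> 1 \<and> s \<ge> 1 \<and>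
     regular_graph V E s \<and> card V = q \<and>
     card S = p \<and> c ` E = S \<and>
     proper_edge_coloring E c \<and>
     (\<forall>k\<in>S. card {e \<in> E. c e = k} = r)"

definition uniformly_colored_graph ::
    "'v set \<Rightarrow> 'v set set \<Rightarrow> 'k set \<Rightarrow> ('v set \<Rightarrow> 'k) \<Rightarrow> bool" where
  "uniformly_colored_graph V E S c \<longleftrightarrow> (\<exists>p q r s. uniformly_colored_type V E S c p q r s)"

end

theory Submission
  imports Defs
begin

text \<open>Since every edge lies inside its own vertex set and \<open>V1\<close>, \<open>V2\<close>
  are disjoint, no edge of one graph meets an edge or a vertex of the other. So each vertex keeps
  its degree in the union, and as both vertex sets are nonempty, the union is regular exactly when
  the two degrees agree (\<open>regular_graph_disjoint_Un_iff\<close>). Every other clause passes to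
  the union: properness because edges of different parts never meet, and the counts because vertex
  sets and color classes are disjoint unions
  (\<open>uniformly_colored_type_disjoint_Un\<close>).\<close>

lemma degree_at_Un_left:
  assumes "simple_graph V2 E2" "v \<notin> V2"
  shows "degree_at (E1 \<union> E2) v = degree_at E1 v"
proof -
  have "{e \<in> E1 \<union> E2. v \<in> e} = {e \<in> E1. v \<in> e}"
    using assms unfolding simple_graph_def by blast
  then show ?thesis by (simp add: degree_at_def)
qed

lemma simple_graph_Un:
  assumes "simple_graph V1 E1" "simple_graph V2 E2"
  shows "simple_graph (V1 \<union> V2) (E1 \<union> E2)"
  using assms unfolding simple_graph_def by blast

lemma simple_graph_disjoint_edges:
  assumes "simple_graph V1 E1" "simple_graph V2 E2" "V1 \<inter> V2 = {}"
    and "e \<in> E1" "f \<in> E2"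
  shows "e \<inter> f = {}"
  using assms unfolding simple_graph_def by blast

text \<open>A common edge would be disjoint from itself, hence empty, but edges have two elements.
  This is what lets the sizes of color classes add up.\<close>

lemma simple_graph_disjoint_edge_sets:
  assumes "simple_graph V1 E1" "simple_graph V2 E2" "V1 \<inter> V2 = {}"
  shows "E1 \<inter> E2 = {}"
proof (rule ccontr)
  assume "E1 \<inter> E2 \<noteq> {}"
  then obtain e where e: "e \<in> E1" "e \<in> E2" by blast
  then have "e = {}"
    using simple_graph_disjoint_edges[OF assms] by blast
  with e(1) assms(1) show False by (auto simp: simple_graph_def)
qed

text \<open>Nonemptiness gives each part a vertex that witnesses its degree in the union; an empty
  part would put no constraint on \<open>s\<close>.\<close>

lemma regular_graph_disjoint_Un_iff:
  assumes "regular_graph V1 E1 s1" "regular_graph V2 E2 s2" "V1 \<inter> V2 = {}"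
    and "V1 \<noteq> {}" "V2 \<noteq> {}"
  shows "regular_graph (V1 \<union> V2) (E1 \<union> E2) s \<longleftrightarrow> s = s1 \<and> s = s2"
proof -
  have simple: "simple_graph V1 E1" "simple_graph V2 E2"
    using assms by (simp_all add: regular_graph_def)
  have "degree_at (E1 \<union> E2) v = s1" if "v \<in> V1" for v
    using that assms degree_at_Un_left[OF simple(2)] unfolding regular_graph_def
    by (metis disjoint_iff)
  moreover have "degree_at (E1 \<union> E2) v = s2" if "v \<in> V2" for v
    \<comment> \<open>The same degree lemma with the two graphs exchanged, hence
      \<open>Un_commute\<close>.\<close>
    using that assms degree_at_Un_left[OF simple(1)] unfolding regular_graph_def
    by (metis Un_commute disjoint_iff)
  ultimately show ?thesis
    using simple_graph_Un[OF simple] assms(4,5) by (auto simp: regular_graph_def)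
qed

text \<open>Allows \<open>c1\<close> and \<open>c2\<close> to be replaced by the single glued
  coloring \<open>c\<close>, with which both graphs are treated from then on.\<close>

lemma uniformly_colored_type_cong:
  assumes "\<And>e. e \<in> E \<Longrightarrow> c e = d e"
  shows "uniformly_colored_type V E S c p q r s \<longleftrightarrow> uniformly_colored_type V E S d p q r s"
proof -
  have "c ` E = d ` E" "proper_edge_coloring E c \<longleftrightarrow> proper_edge_coloring E d"
    "{e \<in> E. c e = k} = {e \<in> E. d e = k}" for k
    using assms by (auto simp: proper_edge_coloring_def)
  then show ?thesis by (simp add: uniformly_colored_type_def)
qed

lemma uniformly_colored_type_disjoint_Un:
  assumes 1: "uniformly_colored_type V1 E1 S c p q1 r1 s"
    and 2: "uniformly_colored_type V2 E2 S c p q2 r2 s"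
    and disj: "V1 \<inter> V2 = {}"
  shows "uniformly_colored_type (V1 \<union> V2) (E1 \<union> E2) S c p (q1 + q2) (r1 + r2) s"
proof -
  have reg: "regular_graph V1 E1 s" "regular_graph V2 E2 s"
    using 1 2 by (simp_all add: uniformly_colored_type_def)
  then have simple: "simple_graph V1 E1" "simple_graph V2 E2"
    by (simp_all add: regular_graph_def)
  \<comment> \<open>Both follow from \<open>q1\<close> and \<open>q2\<close> being positive, as
    empty and infinite sets have \<open>card\<close> equal to 0.\<close>
  have fin: "finite V1" "finite V2" and ne: "V1 \<noteq> {}" "V2 \<noteq> {}"
    using 1 2 card_ge_0_finite[of V1] card_ge_0_finite[of V2]
    by (auto simp: uniformly_colored_type_def)
  have "regular_graph (V1 \<union> V2) (E1 \<union> E2) s"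
    using regular_graph_disjoint_Un_iff[OF reg disj ne] by simp
  moreover have "card (V1 \<union> V2) = q1 + q2"
    using 1 2 fin disj by (simp add: card_Un_disjoint uniformly_colored_type_def)
  moreover have "c ` (E1 \<union> E2) = S"
    using 1 2 by (simp add: image_Un uniformly_colored_type_def)
  moreover have "proper_edge_coloring (E1 \<union> E2) c"
  proof -
    have "proper_edge_coloring E1 c" "proper_edge_coloring E2 c"
      using 1 2 by (simp_all add: uniformly_colored_type_def)
    \<comment> \<open>Both orders are stated because properness quantifies over ordered pairs of
      edges.\<close>
    moreover have "e \<inter> f = {}" "f \<inter> e = {}" if "e \<in> E1" "f \<in> E2" for e f
      using simple_graph_disjoint_edges[OF simple disj that] by auto
    ultimately show ?thesis
      unfolding proper_edge_coloring_def ball_Un by simp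
  qed
  moreover have "card {e \<in> E1 \<union> E2. c e = k} = r1 + r2" if "k \<in> S" for k
  proof -
    \<comment> \<open>Positivity of \<open>r1\<close> and \<open>r2\<close> is kept here to make the
      color classes finite, so that their cardinalities can be added.\<close>
    have card: "card {e \<in> E1. c e = k} = r1" "card {e \<in> E2. c e = k} = r2" "r1 \<ge> 1" "r2 \<ge> 1"
      using 1 2 that by (simp_all add: uniformly_colored_type_def)
    then have "finite {e \<in> E1. c e = k}" "finite {e \<in> E2. c e = k}"
      by (simp_all add: card_ge_0_finite)
    moreover have "{e \<in> E1. c e = k} \<inter> {e \<in> E2. c e = k} = {}"
      using simple_graph_disjoint_edge_sets[OF simple disj] by blast
    moreover have "{e \<in> E1 \<union> E2. c e = k} = {e \<in> E1. c e = k} \<union> {e \<in> E2. c e = k}"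
      by blast
    ultimately show ?thesis
      using card by (simp add: card_Un_disjoint)
  qed
  ultimately show ?thesis
    using 1 2 by (simp add: uniformly_colored_type_def)
qed

theorem proposition4p20:
  fixes V1 V2 :: "'v set" and E1 E2 :: "'v set set"
    and S :: "'k set" and c1 c2 c :: "'v set \<Rightarrow> 'k"
    and p q1 q2 r1 r2 s1 s2 :: nat
  assumes "uniformly_colored_type V1 E1 S c1 p q1 r1 s1"
    and "uniformly_colored_type V2 E2 S c2 p q2 r2 s2"
    and "V1 \<inter> V2 = {}"
    and "\<And>e. e \<in> E1 \<Longrightarrow> c e = c1 e"
    and "\<And>e. e \<in> E2 \<Longrightarrow> c e = c2 e"
  shows "(uniformly_colored_graph (V1 \<union> V2) (E1 \<union> E2) S c \<longleftrightarrow> s1 = s2) \<and>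
    (uniformly_colored_graph (V1 \<union> V2) (E1 \<union> E2) S c \<longrightarrow>
       (\<exists>s. s = s1 \<and> s = s2 \<and>
          uniformly_colored_type (V1 \<union> V2) (E1 \<union> E2) S c p (q1 + q2) (r1 + r2) s))"
proof -
  have 1: "uniformly_colored_type V1 E1 S c p q1 r1 s1"
    using iffD2[OF uniformly_colored_type_cong assms(1)] assms(4) .
  have 2: "uniformly_colored_type V2 E2 S c p q2 r2 s2"
    using iffD2[OF uniformly_colored_type_cong assms(2)] assms(5) .
  have reg: "regular_graph V1 E1 s1" "regular_graph V2 E2 s2"
    and ne: "V1 \<noteq> {}" "V2 \<noteq> {}"
    using 1 2 by (auto simp: uniformly_colored_type_def)
  have "s1 = s2" if "uniformly_colored_graph (V1 \<union> V2) (E1 \<union> E2) S c"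
  proof -
    from that obtain s where "regular_graph (V1 \<union> V2) (E1 \<union> E2) s"
      by (auto simp: uniformly_colored_graph_def uniformly_colored_type_def)
    then show ?thesis
      using regular_graph_disjoint_Un_iff[OF reg assms(3) ne] by simp
  qed
  \<comment> \<open>This one fact yields both the converse implication and the claim about the type,
    with \<open>s1\<close> as the witness for \<open>s\<close>.\<close>
  moreover have "uniformly_colored_type (V1 \<union> V2) (E1 \<union> E2) S c p (q1 + q2) (r1 + r2) s1"
    if "s1 = s2"
    using uniformly_colored_type_disjoint_Un[OF 1 _ assms(3)] 2 that by simp
  ultimately show ?thesis
    by (auto simp: uniformly_colored_graph_def)
qed

end
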